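(* Let $K\subset\mathbb{R}^2$ be a nonempty compact convex set that is lattice-free and unconditional. Then $$\mathrm{p}(K)-2\,\mathrm{D}(K)=\mathrm{p}(K)-4\,\mathrm{R}(K)\leq 2.$$ The inequality is best possible, i.e. the constant $2$ cannot be replaced by any smaller constant valid for all such $K$.
   Context: For a planar convex body $K$ (nonempty compact convex subset of $\mathbb{R}^2$), $\mathrm{p}(K)$ denotes its perimeter, $\mathrm{D}(K)$ its diameter and $\mathrm{R}(K)$ its circumradius (the radius of the smallest Euclidean disk containing $K$), all with respect to the Euclidean norm. The perimeter of a line segment is, by the usual convention, twice its length (and that of a point is $0$). $K$ is called lattice-free if its interior contains no point of the integer lattice $\mathbb{Z}^2$. $K$ is called unconditional if there is a point $z\in\mathbb{R}^2$ such that $K$ is symmetric with respect to (invariant under reflection in) both lines $z+\mathrm{lin}\{e_1\}$ and $z+\mathrm{lin}\{e_2\}$, where $e_1,e_2$ are the standard unit vectors and $\mathrm{lin}$ denotes linear span. *)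

theory Defs
  imports "HOL-Analysis.Analysis"
begin

definition orient :: "real^2 \<Rightarrow> real^2 \<Rightarrow> real^2 \<Rightarrow> real" where
  "orient a b c = (b - a) $ 1 * (c - a) $ 2 - (b - a) $ 2 * (c - a) $ 1"

text \<open>The vertices, listed counterclockwise, of a strictly convex polygon: every triple taken in
  list order turns strictly to the left. Lists of length at most two qualify vacuously and stand for
  degenerate polygons (points and segments).\<close>

definition ccw_polygon :: "(real^2) list \<Rightarrow> bool" where
  "ccw_polygon xs \<longleftrightarrow>
     (\<forall>i j k. i < j \<longrightarrow> j < k \<longrightarrow> k < length xs \<longrightarrow> orient (xs ! i) (xs ! j) (xs ! k) > 0)"

definition closed_polygon_length :: "(real^2) list \<Rightarrow> real" where
  "closed_polygon_length xs = (\<Sum>i<length xs. dist (xs ! i) (xs ! (Suc i mod length xs)))"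

text \<open>Arc length of the boundary of a planar convex body: the supremum of the lengths of the closed
  polygons inscribed in the boundary, with vertices in cyclic order (dropping intermediate collinear
  vertices does not change the length, so strictly convex polygons suffice). A two-element list
  \<open>[a, b]\<close> has closed length \<open>2 * dist a b\<close>; since a segment admits no inscribed polygon with three
  or more vertices, its perimeter is twice its length, and that of a point is \<open>0\<close>. The set below is
  nonempty, and bounded above for every bounded \<open>K\<close>, so the real supremum is meaningful.\<close>

definition perimeter :: "(real^2) set \<Rightarrow> real" where
  "perimeter K = Sup {closed_polygon_length xs | xs. set xs \<subseteq> frontier K \<and> ccw_polygon xs}"

definition circumradius :: "'a::metric_space set \<Rightarrow> real" where
  "circumradius K = Inf {r. 0 \<le> r \<and> (\<exists>c. K \<subseteq> cball c r)}"

definition integer_lattice :: "(real^2) set" where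
  "integer_lattice = {x. \<forall>i. x $ i \<in> \<int>}"

definition lattice_free :: "(real^2) set \<Rightarrow> bool" where
  "lattice_free K \<longleftrightarrow> interior K \<inter> integer_lattice = {}"

text \<open>Orthogonal reflection in the line \<open>z + span {u}\<close>, for \<open>u \<noteq> 0\<close>: twice the foot of the
  perpendicular from \<open>x\<close>, minus \<open>x\<close>.\<close>

definition reflect_line :: "'a::real_inner \<Rightarrow> 'a \<Rightarrow> 'a \<Rightarrow> 'a" where
  "reflect_line z u x = 2 *\<^sub>R (z + (((x - z) \<bullet> u) / (u \<bullet> u)) *\<^sub>R u) - x"

definition unconditional :: "(real^2) set \<Rightarrow> bool" where
  "unconditional K \<longleftrightarrow>
     (\<exists>z. reflect_line z (axis 1 1) ` K = K \<and> reflect_line z (axis 2 1) ` K = K)"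

end

theory Submission
  imports Defs
begin

text \<open>By Cauchy's formula the perimeter of a body \<open>K\<close> with centre \<open>z\<close> and axis symmetries is at most
  \<open>4 \<integral> G\<close> over \<open>[0, \<pi>/2]\<close>, for every upper bound \<open>G\<close> of its support function about \<open>z\<close>. A lattice point
  nearest to \<open>z\<close> is not interior to \<open>K\<close>, so symmetrising a supporting line there puts \<open>K - z\<close>
  in a rhombus \<open>k \<bar>x\<bar> + \<bar>y\<bar> \<le> (1 + k)/2\<close> with \<open>0 \<le> k \<le> 1\<close> (up to exchanging the axes).
  If \<open>R \<le> (2 + \<surd>2)/4\<close>, the disk bound \<open>G = R\<close> gives \<open>p \<le> 2 \<pi> R \<le> 4 R + 2\<close>. For larger \<open>R\<close> the
  rhombus cut by the strip \<open>\<bar>x\<bar> \<le> R\<close> has perimeter at most \<open>4 R + 2\<close>. The boxes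
  \<open>[-a, a] \<times> [0, 1]\<close> with \<open>a\<close> tending to infinity show that the constant is optimal.\<close>

section \<open>Cauchy's perimeter estimate\<close>

text \<open>The integrand is the support function, in first-quadrant directions, of the rhombus with
  half-diagonals \<open>a\<close> and \<open>b\<close> along the axes; the value is its side, a
  quarter of its perimeter.\<close>

lemma has_integral_max_cos_sin:
  fixes a b :: real
  assumes "0 \<le> a" "0 \<le> b"
  shows "((\<lambda>t. max (a * cos t) (b * sin t)) has_integral sqrt (a\<^sup>2 + b\<^sup>2)) {0..pi/2}"
proof (cases "a = 0 \<and> b = 0")
  case True
  then show ?thesis by simp
next
  case False
  define r where "r = sqrt (a\<^sup>2 + b\<^sup>2)"
  have r: "r > 0" "r\<^sup>2 = a\<^sup>2 + b\<^sup>2"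
    using False unfolding r_def by (simp_all add: sum_power2_gt_zero_iff)
  have "(b / r)\<^sup>2 + (a / r)\<^sup>2 = (a\<^sup>2 + b\<^sup>2) / r\<^sup>2"
    by (simp add: power_divide add_divide_distrib)
  also have "\<dots> = 1"
    using r by (simp flip: r(2))
  finally have "(b / r)\<^sup>2 + (a / r)\<^sup>2 = 1" .
  \<comment> \<open>The two terms cross at the angle \<open>u\<close>: the cosine term dominates
    before it, the sine term after it.\<close>
  then obtain u where u: "0 \<le> u" "u \<le> pi/2" "b / r = cos u" "a / r = sin u"
    using sincos_total_pi_half[of "b / r" "a / r"] assms r by auto
  have ab: "a = r * sin u" "b = r * cos u"
    using u r by (auto simp: field_simps)
  have diff: "a * cos t - b * sin t = r * sin (u - t)" for t
    by (simp add: ab sin_diff algebra_simps)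
  have "((\<lambda>t. a * cos t) has_integral (a * sin u - a * sin 0)) {0..u}"
    by (rule fundamental_theorem_of_calculus)
       (use u in \<open>auto intro!: derivative_eq_intros
          simp flip: has_real_derivative_iff_has_vector_derivative\<close>)
  moreover have "max (a * cos t) (b * sin t) = a * cos t" if "t \<in> {0..u}" for t
  proof -
    have "0 \<le> r * sin (u - t)"
      using that u r by (intro mult_nonneg_nonneg sin_ge_zero) auto
    then show ?thesis using diff[of t] by auto
  qed
  ultimately have 1: "((\<lambda>t. max (a * cos t) (b * sin t)) has_integral a * sin u) {0..u}"
    by (auto intro: has_integral_eq[rotated])
  have "((\<lambda>t. b * sin t) has_integral (- b * cos (pi/2) - - b * cos u)) {u..pi/2}"
    by (rule fundamental_theorem_of_calculus)
       (use u in \<open>auto intro!: derivative_eq_intros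
          simp flip: has_real_derivative_iff_has_vector_derivative\<close>)
  moreover have "max (a * cos t) (b * sin t) = b * sin t" if "t \<in> {u..pi/2}" for t
  proof -
    have "0 \<le> r * sin (t - u)"
      using that u r by (intro mult_nonneg_nonneg sin_ge_zero) auto
    moreover have "sin (u - t) = - sin (t - u)"
      by (metis minus_diff_eq sin_minus)
    ultimately show ?thesis using diff[of t] by auto
  qed
  ultimately have 2: "((\<lambda>t. max (a * cos t) (b * sin t)) has_integral b * cos u) {u..pi/2}"
    by (auto intro: has_integral_eq[rotated])
  have "a * sin u + b * cos u = r * ((sin u)\<^sup>2 + (cos u)\<^sup>2)"
    by (simp only: ab power2_eq_square) (simp only: algebra_simps)
  then have "a * sin u + b * cos u = sqrt (a\<^sup>2 + b\<^sup>2)"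
    by (simp add: r_def)
  with has_integral_combine[OF u(1,2) 1 2] show ?thesis by simp
qed

text \<open>The identity \<open>\<bar>A + B\<bar> + \<bar>A - B\<bar> = 2 * max \<bar>A\<bar>
  \<bar>B\<bar>\<close> reduces this to the previous integral. It recovers the length of an edge
  \<open>(p, q)\<close> from its projections onto the mirror directions
  \<open>(cos t, sin t)\<close> and \<open>(cos t, - sin t)\<close>.\<close>

lemma has_integral_abs_projections:
  fixes p q :: real
  shows "((\<lambda>t. \<bar>p * cos t + q * sin t\<bar> + \<bar>p * cos t - q * sin t\<bar>)
           has_integral 2 * sqrt (p\<^sup>2 + q\<^sup>2)) {0..pi/2}"
proof -
  have eq: "2 * max (\<bar>p\<bar> * cos t) (\<bar>q\<bar> * sin t) =
      \<bar>p * cos t + q * sin t\<bar> + \<bar>p * cos t - q * sin t\<bar>" if "t \<in> {0..pi/2}" for t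
  proof -
    have "0 \<le> cos t" "0 \<le> sin t"
      using that by (auto intro!: cos_ge_zero sin_ge_zero)
    then have "\<bar>p\<bar> * cos t = \<bar>p * cos t\<bar>" "\<bar>q\<bar> * sin t = \<bar>q * sin t\<bar>"
      by (simp_all add: abs_mult)
    then show ?thesis by (auto simp: max_def abs_if)
  qed
  have "((\<lambda>t. 2 * max (\<bar>p\<bar> * cos t) (\<bar>q\<bar> * sin t)) has_integral 2 * sqrt (p\<^sup>2 + q\<^sup>2)) {0..pi/2}"
    using has_integral_mult_right[OF has_integral_max_cos_sin[of "\<bar>p\<bar>" "\<bar>q\<bar>"], of 2] by simp
  then show ?thesis by (rule has_integral_eq[rotated]) (rule eq)
qed

section \<open>Variation of a linear functional around a convex polygon\<close>

lemma cyclic_sum_rotate: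
  fixes F :: "'b \<Rightarrow> 'b \<Rightarrow> 'a::comm_monoid_add"
  shows "(\<Sum>i<length xs. F (rotate m xs ! i) (rotate m xs ! (Suc i mod length xs))) =
   (\<Sum>i<length xs. F (xs ! i) (xs ! (Suc i mod length xs)))"
proof -
  have rotate1: "(\<Sum>i<length xs. F (rotate1 xs ! i) (rotate1 xs ! (Suc i mod length xs))) =
      (\<Sum>i<length xs. F (xs ! i) (xs ! (Suc i mod length xs)))" for xs :: "'b list"
  proof (cases "length xs")
    case (Suc m)
    define G where "G j = F (xs ! j) (xs ! (Suc j mod length xs))" for j
    have "(\<Sum>i<length xs. F (rotate1 xs ! i) (rotate1 xs ! (Suc i mod length xs))) =
        (\<Sum>i<length xs. G (Suc i mod length xs))"
      by (rule sum.cong) (use Suc in \<open>auto simp: nth_rotate1 G_def\<close>)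
    also have "\<dots> = (\<Sum>i<m. G (Suc i)) + G 0"
      by (simp add: Suc)
    also have "\<dots> = (\<Sum>i<length xs. G i)"
      by (simp only: Suc sum.lessThan_Suc_shift add.commute)
    finally show ?thesis by (simp add: G_def)
  qed simp
  show ?thesis
  proof (induction m)
    case (Suc m)
    then show ?case using rotate1[of "rotate m xs"] by simp
  qed simp
qed

lemma orient_cycle: "orient b c a = orient a b c"
  by (simp add: orient_def algebra_simps)

lemma ccw_polygon_rotate:
  assumes "ccw_polygon xs"
  shows "ccw_polygon (rotate m xs)"
proof -
  have rotate1: "ccw_polygon (rotate1 xs)" if xs: "ccw_polygon xs" for xs
    unfolding ccw_polygon_def
  proof (intro allI impI)
    fix i j k assume ijk: "i < j" "j < k" "k < length (rotate1 xs)"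
    show "0 < orient (rotate1 xs ! i) (rotate1 xs ! j) (rotate1 xs ! k)"
    proof (cases "Suc k = length xs")
      case True
      \<comment> \<open>\<open>rotate1\<close> moves \<open>xs ! 0\<close> to the end, so a triple
        ending there is a cyclic shift of a triple of \<open>xs\<close> starting at
        \<open>0\<close>.\<close>
      then have "0 < orient (xs ! 0) (xs ! Suc i) (xs ! Suc j)"
        using xs ijk unfolding ccw_polygon_def by auto
      then show ?thesis using ijk True by (simp add: nth_rotate1 orient_cycle)
    next
      case False
      then show ?thesis using xs ijk unfolding ccw_polygon_def by (simp add: nth_rotate1)
    qed
  qed
  show ?thesis by (induction m) (auto simp: assms rotate1)
qed

text \<open>The diagonals \<open>ac\<close> and \<open>bd\<close> of a convex quadrilateral meet; the identity in the proof
  compares the values of \<open>y\<close> at the two barycentric expressions of the intersection point.\<close>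
lemma ccw_quadrilateral_not_zigzag:
  fixes p q :: real
  defines "y \<equiv> \<lambda>x::real^2. p * x $ 1 + q * x $ 2"
  assumes pos: "0 < orient a b c" "0 < orient a c d" "0 < orient b c d"
  shows "\<not> (y a \<le> y c \<and> y c < y b \<and> y c < y d)"
proof
  assume *: "y a \<le> y c \<and> y c < y b \<and> y c < y d"
  have "orient a c d * (y b - y c) + orient a b c * (y d - y c) = orient b c d * (y a - y c)"
    by (simp add: y_def orient_def algebra_simps)
  moreover have "0 < orient a c d * (y b - y c) + orient a b c * (y d - y c)"
    using * pos by (intro add_pos_pos mult_pos_pos) auto
  moreover have "orient b c d * (y a - y c) \<le> 0"
    using * pos by (intro mult_nonneg_nonpos) auto
  ultimately show False by linarith
qed

text \<open>Without a strict valley among the positive indices, the values climb from the minimum at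
  \<open>0\<close> to a maximum at \<open>m\<close> and then descend, so the cyclic sum telescopes
  to twice the range.\<close>

lemma cyclic_variation_unimodal:
  fixes y :: "nat \<Rightarrow> real"
  assumes n: "0 < n"
    and zero: "\<And>i. i < n \<Longrightarrow> y 0 \<le> y i"
    and uni: "\<And>i j k. 0 < i \<Longrightarrow> i < j \<Longrightarrow> j < k \<Longrightarrow> k < n \<Longrightarrow> \<not> (y j < y i \<and> y j < y k)"
  obtains m where "m < n" "(\<Sum>i<n. \<bar>y (Suc i mod n) - y i\<bar>) = 2 * (y m - y 0)"
proof -
  obtain m where m: "m < n" "\<And>i. i < n \<Longrightarrow> y i \<le> y m"
  proof -
    have "finite {..<n}" "{..<n} \<noteq> {}" using n by auto
    then obtain m where "is_arg_min (\<lambda>i. - y i) (\<lambda>i. i \<in> {..<n}) m"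
      using ex_is_arg_min_if_finite by metis
    then show ?thesis using that[of m] by (auto simp: is_arg_min_linorder)
  qed
  obtain l where l: "n = Suc l" using n by (cases n) auto
  have up: "y i \<le> y (Suc i)" if "i < m" for i
  proof (cases "i = 0 \<or> Suc i = m")
    case True
    then show ?thesis using that zero m by auto
  next
    case False
    then show ?thesis using uni[of i "Suc i" m] m that m(2)[of i] by fastforce
  qed
  have down: "y (Suc i) \<le> y i" if "m \<le> i" "i < l" for i
  proof (cases "i = m \<or> m = 0")
    case True
    then show ?thesis
    proof
      \<comment> \<open>A maximum at the index of the minimum makes all values equal;
        \<open>uni\<close> only speaks of positive indices.\<close>
      assume "m = 0"
      then have "y i = y 0" "y (Suc i) = y 0"
        using m(2) zero that l by (auto intro: order_antisym)
      then show ?thesis by simp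
    qed (use m l that in auto)
  next
    case False
    then show ?thesis using uni[of m i "Suc i"] m(2)[of "Suc i"] that l by fastforce
  qed
  have "(\<Sum>i<l. \<bar>y (Suc i) - y i\<bar>) =
      (\<Sum>i<m. \<bar>y (Suc i) - y i\<bar>) + (\<Sum>i=m..<l. \<bar>y (Suc i) - y i\<bar>)"
    using m l sum.atLeastLessThan_concat[of 0 m l "\<lambda>i. \<bar>y (Suc i) - y i\<bar>"]
    by (simp add: lessThan_atLeast0)
  also have "(\<Sum>i<m. \<bar>y (Suc i) - y i\<bar>) = (\<Sum>i<m. y (Suc i) - y i)"
    by (rule sum.cong) (use up in auto)
  also have "\<dots> = y m - y 0"
    by (rule sum_lessThan_telescope)
  also have "(\<Sum>i=m..<l. \<bar>y (Suc i) - y i\<bar>) = - (\<Sum>i=m..<l. y (Suc i) - y i)"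
    unfolding sum_negf[symmetric] by (rule sum.cong) (use down in auto)
  also have "\<dots> = y m - y l"
    using sum_Suc_diff'[of m l y] m l by simp
  finally have "(\<Sum>i<l. \<bar>y (Suc i) - y i\<bar>) = 2 * y m - y 0 - y l" by simp
  \<comment> \<open>The extra term is the closing step from index \<open>l\<close> back to
    \<open>0\<close>.\<close>
  moreover have "(\<Sum>i<n. \<bar>y (Suc i mod n) - y i\<bar>) = (\<Sum>i<l. \<bar>y (Suc i) - y i\<bar>) + \<bar>y 0 - y l\<bar>"
    by (simp add: l)
  moreover have "y 0 \<le> y l" using zero l by auto
  ultimately show ?thesis using that[of m] m by auto
qed

text \<open>Started at a vertex of least value, the polygon gives a unimodal sequence of values of
  the functional. Its variation is twice the range, and the range is at most \<open>2 * G\<close>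
  because all values lie within \<open>G\<close> of \<open>c\<close>.\<close>

lemma ccw_polygon_linear_variation:
  fixes p q :: real
  assumes xs: "ccw_polygon xs" "xs \<noteq> []"
    and le: "\<And>x. x \<in> set xs \<Longrightarrow> \<bar>p * x $ 1 + q * x $ 2 - c\<bar> \<le> G"
  shows "(\<Sum>i<length xs. \<bar>p * (xs ! i - xs ! (Suc i mod length xs)) $ 1
            + q * (xs ! i - xs ! (Suc i mod length xs)) $ 2\<bar>) \<le> 4 * G"
proof -
  define y where "y = (\<lambda>x::real^2. p * x $ 1 + q * x $ 2)"
  have "finite (set xs)" "set xs \<noteq> {}" using xs by auto
  then obtain a where a: "a \<in> set xs" "\<And>x. x \<in> set xs \<Longrightarrow> y a \<le> y x"
    using ex_is_arg_min_if_finite[of "set xs" y] by (auto simp: is_arg_min_linorder)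
  then obtain m where m: "m < length xs" "a = xs ! m" by (auto simp: in_set_conv_nth)
  define zs where "zs = rotate m xs"
  have zs: "ccw_polygon zs" "length zs = length xs" "set zs = set xs"
    using xs ccw_polygon_rotate unfolding zs_def by auto
  have zs0: "zs ! 0 = a"
    using m xs nth_rotate[of 0 xs m] by (simp add: zs_def)
  have zs_in: "zs ! i \<in> set xs" if "i < length xs" for i
    using that zs nth_mem[of i zs] by simp
  obtain k where k: "k < length zs"
    "(\<Sum>i<length zs. \<bar>y (zs ! (Suc i mod length zs)) - y (zs ! i)\<bar>) = 2 * (y (zs ! k) - y (zs ! 0))"
  proof (rule cyclic_variation_unimodal[of "length zs" "\<lambda>i. y (zs ! i)"])
    show "0 < length zs" using xs zs by simp
    show "y (zs ! 0) \<le> y (zs ! i)" if "i < length zs" for i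
      using a(2) zs_in that zs by (simp add: zs0)
    fix i j k assume ijk: "0 < i" "i < j" "j < k" "k < length zs"
    have "0 < orient (zs ! 0) (zs ! i) (zs ! j)" "0 < orient (zs ! 0) (zs ! j) (zs ! k)"
      "0 < orient (zs ! i) (zs ! j) (zs ! k)"
      using zs(1) ijk unfolding ccw_polygon_def by auto
    moreover have "y (zs ! 0) \<le> y (zs ! j)"
      using a(2) zs_in ijk zs by (simp add: zs0)
    ultimately show "\<not> (y (zs ! j) < y (zs ! i) \<and> y (zs ! j) < y (zs ! k))"
      using ccw_quadrilateral_not_zigzag[of "zs ! 0" "zs ! i" "zs ! j" "zs ! k" p q]
      unfolding y_def by blast
  qed blast
  have "(\<Sum>i<length xs. \<bar>p * (xs ! i - xs ! (Suc i mod length xs)) $ 1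
            + q * (xs ! i - xs ! (Suc i mod length xs)) $ 2\<bar>) =
      (\<Sum>i<length xs. \<bar>y (xs ! (Suc i mod length xs)) - y (xs ! i)\<bar>)"
    by (rule sum.cong) (auto simp: y_def algebra_simps abs_if)
  also have "\<dots> = (\<Sum>i<length zs. \<bar>y (zs ! (Suc i mod length zs)) - y (zs ! i)\<bar>)"
    using cyclic_sum_rotate[of "\<lambda>u v. \<bar>y v - y u\<bar>" m xs] zs(2) by (simp add: zs_def)
  also have "\<dots> = 2 * (y (zs ! k) - y (zs ! 0))" by (rule k(2))
  also have "\<dots> \<le> 4 * G"
    using le[of "zs ! k"] le[of "zs ! 0"] zs_in[of k] zs_in[of 0] k(1) zs xs
    unfolding y_def by (auto simp: abs_le_iff)
  finally show ?thesis .
qed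

section \<open>From support bounds to perimeter bounds\<close>

lemma dist_real2: "dist x y = sqrt (((x - y) $ 1)\<^sup>2 + ((x - y) $ 2)\<^sup>2)" for x y :: "real^2"
  by (simp add: dist_vec_def L2_set_def sum_2 dist_real_def)

text \<open>Twice the length is the integral of the edge projections onto the directions
  \<open>(cos t, sin t)\<close> and \<open>(cos t, - sin t)\<close>. In each direction the
  projections sum to at most \<open>4 * G t\<close>, by the variation bound. The absolute values in
  \<open>le\<close> let one \<open>G\<close> serve both directions.\<close>

lemma closed_polygon_length_le_integral:
  fixes z :: "real^2"
  assumes xs: "ccw_polygon xs" "xs \<noteq> []"
    and le: "\<And>x t. x \<in> set xs \<Longrightarrow> t \<in> {0..pi/2} \<Longrightarrow>
      \<bar>x $ 1 - z $ 1\<bar> * cos t + \<bar>x $ 2 - z $ 2\<bar> * sin t \<le> G t"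
    and G: "(G has_integral I) {0..pi/2}"
  shows "closed_polygon_length xs \<le> 4 * I"
proof -
  define e where "e i = xs ! i - xs ! (Suc i mod length xs)" for i
  define P where "P t = (\<Sum>i<length xs. \<bar>e i $ 1 * cos t + e i $ 2 * sin t\<bar>
      + \<bar>e i $ 1 * cos t - e i $ 2 * sin t\<bar>)" for t
  have "(P has_integral (\<Sum>i<length xs. 2 * sqrt ((e i $ 1)\<^sup>2 + (e i $ 2)\<^sup>2))) {0..pi/2}"
    unfolding P_def by (intro has_integral_sum has_integral_abs_projections) auto
  then have "(P has_integral 2 * closed_polygon_length xs) {0..pi/2}"
    unfolding closed_polygon_length_def dist_real2 e_def by (simp add: sum_distrib_left)
  moreover have "((\<lambda>t. 8 * G t) has_integral 8 * I) {0..pi/2}"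
    using G by (rule has_integral_mult_right)
  moreover have "P t \<le> 8 * G t" if t: "t \<in> {0..pi/2}" for t
  proof -
    have cs: "0 \<le> cos t" "0 \<le> sin t"
      using t by (auto intro!: cos_ge_zero sin_ge_zero)
    \<comment> \<open>The sign of \<open>s\<close> selects one of the two mirror directions.\<close>
    have bound: "(\<Sum>i<length xs. \<bar>cos t * e i $ 1 + s * e i $ 2\<bar>) \<le> 4 * G t"
      if s: "\<bar>s\<bar> = sin t" for s
      unfolding e_def
    proof (rule ccw_polygon_linear_variation[OF xs, where c = "cos t * z $ 1 + s * z $ 2"])
      fix x assume "x \<in> set xs"
      have "\<bar>cos t * x $ 1 + s * x $ 2 - (cos t * z $ 1 + s * z $ 2)\<bar> =
          \<bar>(x $ 1 - z $ 1) * cos t + (x $ 2 - z $ 2) * s\<bar>"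
        by (simp add: algebra_simps)
      also have "\<dots> \<le> \<bar>x $ 1 - z $ 1\<bar> * cos t + \<bar>x $ 2 - z $ 2\<bar> * sin t"
        using abs_triangle_ineq[of "(x $ 1 - z $ 1) * cos t" "(x $ 2 - z $ 2) * s"] cs s
        by (simp add: abs_mult)
      also have "\<dots> \<le> G t" by (rule le) fact+
      finally show "\<bar>cos t * x $ 1 + s * x $ 2 - (cos t * z $ 1 + s * z $ 2)\<bar> \<le> G t" .
    qed
    have "P t = (\<Sum>i<length xs. \<bar>cos t * e i $ 1 + sin t * e i $ 2\<bar>)
        + (\<Sum>i<length xs. \<bar>cos t * e i $ 1 + - sin t * e i $ 2\<bar>)"
      unfolding P_def sum.distrib by (simp add: mult.commute)
    also have "\<dots> \<le> 4 * G t + 4 * G t"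
      using cs by (intro add_mono bound) auto
    finally show ?thesis by simp
  qed
  ultimately have "2 * closed_polygon_length xs \<le> 8 * I"
    by (rule has_integral_le)
  then show ?thesis by simp
qed

lemma norm_real2_eq: "(norm (x :: real^2))\<^sup>2 = (x $ 1)\<^sup>2 + (x $ 2)\<^sup>2"
  by (simp add: norm_vec_def L2_set_def sum_2)

lemma closed_polygon_length_le_circle:
  fixes z :: "real^2"
  assumes xs: "ccw_polygon xs" "xs \<noteq> []" and le: "\<And>x. x \<in> set xs \<Longrightarrow> norm (x - z) \<le> R"
  shows "closed_polygon_length xs \<le> 2 * pi * R"
proof -
  have "closed_polygon_length xs \<le> 4 * (pi / 2 * R)"
  proof (rule closed_polygon_length_le_integral[OF xs])
    show "((\<lambda>t. R) has_integral pi / 2 * R) {0..pi/2}"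
      using has_integral_const_real[of R 0 "pi/2"] by simp
    fix x t assume x: "x \<in> set xs" and "t \<in> {0..pi/2}"
    have "\<bar>x $ 1 - z $ 1\<bar> * cos t + \<bar>x $ 2 - z $ 2\<bar> * sin t \<le> norm (x - z)"
    proof (rule power2_le_imp_le)
      \<comment> \<open>Lagrange's identity; dropping the second square gives the Cauchy-Schwarz
        inequality.\<close>
      have "(\<bar>x $ 1 - z $ 1\<bar> * cos t + \<bar>x $ 2 - z $ 2\<bar> * sin t)\<^sup>2 +
          (\<bar>x $ 1 - z $ 1\<bar> * sin t - \<bar>x $ 2 - z $ 2\<bar> * cos t)\<^sup>2 =
          (\<bar>x $ 1 - z $ 1\<bar>\<^sup>2 + \<bar>x $ 2 - z $ 2\<bar>\<^sup>2) * ((sin t)\<^sup>2 + (cos t)\<^sup>2)"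
        by (simp only: power2_eq_square) (simp only: algebra_simps)
      also have "\<dots> = (norm (x - z))\<^sup>2"
        by (simp add: norm_real2_eq)
      finally show "(\<bar>x $ 1 - z $ 1\<bar> * cos t + \<bar>x $ 2 - z $ 2\<bar> * sin t)\<^sup>2 \<le> (norm (x - z))\<^sup>2"
        by (smt (verit) zero_le_power2)
    qed simp
    with le[OF x] show "\<bar>x $ 1 - z $ 1\<bar> * cos t + \<bar>x $ 2 - z $ 2\<bar> * sin t \<le> R" by simp
  qed
  then show ?thesis by (simp add: mult.commute)
qed

section \<open>Bodies contained in a rhombus\<close>

text \<open>When the strip \<open>\<bar>x\<bar> \<le> R\<close> cuts the rhombus
  \<open>k * \<bar>x\<bar> + \<bar>y\<bar> \<le> (1 + k) / 2\<close>, the left side is a quarter of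
  the perimeter of the intersection. With \<open>w = sqrt (1 + k\<^sup>2)\<close> the claim reads
  \<open>2 * k \<le> 4 * R * (1 + k - w)\<close>, where \<open>2 * k\<close> factors as
  \<open>(1 + k - w) * (1 + k + w)\<close>. The threshold on \<open>R\<close> is the largest value
  of \<open>(1 + k + w) / 4\<close>, taken at \<open>k = 1\<close>.\<close>

lemma rhombus_strip_estimate:
  fixes R k :: real
  assumes "0 \<le> k" "k \<le> 1" and R: "(2 + sqrt 2) / 4 \<le> R"
  shows "(1 + k) / 2 + R * (sqrt (1 + k\<^sup>2) - k) \<le> R + 1 / 2"
proof -
  define w where "w = sqrt (1 + k\<^sup>2)"
  have w: "w\<^sup>2 = 1 + k\<^sup>2" "0 \<le> w" unfolding w_def by auto
  have "w \<le> sqrt 2"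
    unfolding w_def using assms by (simp add: power_le_one)
  then have s: "1 + k + w \<le> 4 * R" using assms by simp
  have "(1 + k - w) * (1 + k + w) = 2 * k"
    using w by (simp add: power2_eq_square algebra_simps)
  moreover have "0 \<le> 1 + k - w"
    unfolding w_def using assms by (simp add: real_le_lsqrt power2_eq_square algebra_simps)
  then have "(1 + k - w) * (1 + k + w) \<le> (1 + k - w) * (4 * R)"
    using s by (intro mult_left_mono)
  ultimately have "2 * k \<le> (1 + k - w) * (4 * R)" by linarith
  then show ?thesis by (simp add: w_def[symmetric] field_simps)
qed

text \<open>The claim is equivalent to \<open>R \<le> 1 / (pi - 2)\<close>, about
  \<open>0.876\<close>, while the threshold is about \<open>0.854\<close>.\<close>

lemma circle_estimate:
  fixes R :: real
  assumes "R \<le> (2 + sqrt 2) / 4"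
  shows "2 * pi * R \<le> 4 * R + 2"
proof -
  have "sqrt 2 \<le> 1.415" by (rule real_le_lsqrt) (auto simp: power2_eq_square)
  then have "R \<le> 0.85375" using assms by simp
  then have "(2 * pi - 4) * R \<le> (2 * pi - 4) * 0.85375"
    using pi_ge_two by (intro mult_left_mono) auto
  also have "\<dots> \<le> 2" using pi_approx(2) by simp
  finally show ?thesis by (simp add: algebra_simps)
qed

text \<open>Eliminating \<open>v\<close> leaves \<open>u * (c - k * s)\<close>, which is linear in
  \<open>u\<close> on \<open>[0, R]\<close> and hence at most \<open>R\<close> times the positive
  part of \<open>c - k * s\<close>. Writing that part with \<open>max c (k * s)\<close> makes it
  integrable by \<open>has_integral_max_cos_sin\<close>.\<close>

lemma rhombus_strip_support:
  fixes u v c s k R :: real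
  assumes "0 \<le> u" "u \<le> R" "0 \<le> s" "k * u + v \<le> (1 + k) / 2"
  shows "u * c + v * s \<le> (1 + k) / 2 * s + R * (max c (k * s) - k * s)"
proof -
  have "v * s \<le> ((1 + k) / 2 - k * u) * s"
    using assms(3,4) by (intro mult_right_mono) linarith+
  moreover have "u * (c - k * s) \<le> u * (max c (k * s) - k * s)"
    using assms by (intro mult_left_mono) auto
  moreover have "u * (max c (k * s) - k * s) \<le> R * (max c (k * s) - k * s)"
    using assms by (intro mult_right_mono) auto
  ultimately show ?thesis by (simp add: field_simps)
qed

text \<open>Small \<open>R\<close> is settled by the disk alone, large \<open>R\<close> by the
  rhombus cut by a strip. The strip bounds the coordinate of smaller weight, so that the ratio
  \<open>k\<close> of the weights is at most \<open>1\<close>.\<close>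

lemma closed_polygon_length_le_rhombus:
  fixes z :: "real^2"
  assumes xs: "ccw_polygon xs" "xs \<noteq> []" and le: "\<And>x. x \<in> set xs \<Longrightarrow> norm (x - z) \<le> R"
    and a: "0 \<le> a1" "0 \<le> a2" "0 < a1 + a2"
    and rhombus: "\<And>x. x \<in> set xs \<Longrightarrow> a1 * \<bar>x $ 1 - z $ 1\<bar> + a2 * \<bar>x $ 2 - z $ 2\<bar> \<le> (a1 + a2) / 2"
  shows "closed_polygon_length xs \<le> 4 * R + 2"
proof (cases "R \<le> (2 + sqrt 2) / 4")
  case True
  then show ?thesis
    using closed_polygon_length_le_circle[OF xs le] circle_estimate by fastforce
next
  case False
  have cs: "0 \<le> cos t" "0 \<le> sin t" if "t \<in> {0..pi/2}" for t
    using that by (auto intro!: cos_ge_zero sin_ge_zero)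
  have coord: "\<bar>x $ i - z $ i\<bar> \<le> R" if "x \<in> set xs" for x i
    using component_le_norm_cart[of "x - z" i] le[OF that] by simp
  have int_sin: "((\<lambda>t. sin t) has_integral 1) {0..pi/2}"
    by (rule has_integral_eq[where f = "\<lambda>t. max (0 * cos t) (1 * sin t)"])
       (use cs has_integral_max_cos_sin[of 0 1] in auto)
  have int_cos: "((\<lambda>t. cos t) has_integral 1) {0..pi/2}"
    by (rule has_integral_eq[where f = "\<lambda>t. max (1 * cos t) (0 * sin t)"])
       (use cs has_integral_max_cos_sin[of 1 0] in auto)
  show ?thesis
  proof (cases "a1 \<le> a2")
    case True
    define k where "k = a1 / a2"
    have k: "0 \<le> k" "k \<le> 1" using a True by (auto simp: k_def)
    have a2: "0 < a2" "a1 = k * a2" using a True by (auto simp: k_def)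
    have "closed_polygon_length xs \<le> 4 * ((1 + k) / 2 * 1 + R * (sqrt (1\<^sup>2 + k\<^sup>2) - k * 1))"
    proof (rule closed_polygon_length_le_integral[OF xs])
      show "((\<lambda>t. (1 + k) / 2 * sin t + R * (max (1 * cos t) (k * sin t) - k * sin t)) has_integral
          (1 + k) / 2 * 1 + R * (sqrt (1\<^sup>2 + k\<^sup>2) - k * 1)) {0..pi/2}"
        by (intro has_integral_add has_integral_mult_right has_integral_diff
            has_integral_max_cos_sin int_sin) (use k in auto)
      fix x t assume x: "x \<in> set xs" and t: "t \<in> {0..pi/2}"
      have "k * \<bar>x $ 1 - z $ 1\<bar> + \<bar>x $ 2 - z $ 2\<bar> \<le> (1 + k) / 2"
      proof (rule mult_left_le_imp_le[OF _ a2(1)])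
        show "a2 * (k * \<bar>x $ 1 - z $ 1\<bar> + \<bar>x $ 2 - z $ 2\<bar>) \<le> a2 * ((1 + k) / 2)"
          using rhombus[OF x] by (simp add: a2(2) algebra_simps)
      qed
      from rhombus_strip_support[OF _ coord[OF x] cs(2)[OF t] this, of "cos t"]
      show "\<bar>x $ 1 - z $ 1\<bar> * cos t + \<bar>x $ 2 - z $ 2\<bar> * sin t
          \<le> (1 + k) / 2 * sin t + R * (max (1 * cos t) (k * sin t) - k * sin t)"
        by simp
    qed
    with rhombus_strip_estimate[OF k, of R] False show ?thesis by simp argo
  next
    case less: False
    \<comment> \<open>The same argument with the axes, and hence sine and cosine, exchanged.\<close>
    define k where "k = a2 / a1"
    have k: "0 \<le> k" "k \<le> 1" using a less by (auto simp: k_def)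
    have a1: "0 < a1" "a2 = k * a1" using a less by (auto simp: k_def)
    have "closed_polygon_length xs \<le> 4 * ((1 + k) / 2 * 1 + R * (sqrt (k\<^sup>2 + 1\<^sup>2) - k * 1))"
    proof (rule closed_polygon_length_le_integral[OF xs])
      show "((\<lambda>t. (1 + k) / 2 * cos t + R * (max (k * cos t) (1 * sin t) - k * cos t)) has_integral
          (1 + k) / 2 * 1 + R * (sqrt (k\<^sup>2 + 1\<^sup>2) - k * 1)) {0..pi/2}"
        by (intro has_integral_add has_integral_mult_right has_integral_diff
            has_integral_max_cos_sin int_cos) (use k in auto)
      fix x t assume x: "x \<in> set xs" and t: "t \<in> {0..pi/2}"
      have "k * \<bar>x $ 2 - z $ 2\<bar> + \<bar>x $ 1 - z $ 1\<bar> \<le> (1 + k) / 2"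
      proof (rule mult_left_le_imp_le[OF _ a1(1)])
        show "a1 * (k * \<bar>x $ 2 - z $ 2\<bar> + \<bar>x $ 1 - z $ 1\<bar>) \<le> a1 * ((1 + k) / 2)"
          using rhombus[OF x] by (simp add: a1(2) algebra_simps)
      qed
      from rhombus_strip_support[OF _ coord[OF x] cs(1)[OF t] this, of "sin t"]
      show "\<bar>x $ 1 - z $ 1\<bar> * cos t + \<bar>x $ 2 - z $ 2\<bar> * sin t
          \<le> (1 + k) / 2 * cos t + R * (max (k * cos t) (1 * sin t) - k * cos t)"
        by (simp add: max.commute add.commute)
    qed
    with rhombus_strip_estimate[OF k, of R] False show ?thesis by (simp add: add.commute) argo
  qed
qed

section \<open>Unconditional bodies\<close>

lemma reflect_line_axis1: "reflect_line z (axis 1 1) x = vector [x $ 1, 2 * z $ 2 - x $ 2]"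
  for x z :: "real^2"
  by (simp add: reflect_line_def inner_axis vec_eq_iff forall_2 inner_axis_axis) (simp add: axis_def)

lemma reflect_line_axis2: "reflect_line z (axis 2 1) x = vector [2 * z $ 1 - x $ 1, x $ 2]"
  for x z :: "real^2"
  by (simp add: reflect_line_def inner_axis vec_eq_iff forall_2 inner_axis_axis) (simp add: axis_def)

lemma unconditional_centre:
  assumes "unconditional K"
  obtains z :: "real^2" where "\<And>x. x \<in> K \<Longrightarrow> vector [x $ 1, 2 * z $ 2 - x $ 2] \<in> K"
    and "\<And>x. x \<in> K \<Longrightarrow> vector [2 * z $ 1 - x $ 1, x $ 2] \<in> K"
  using assms unfolding unconditional_def reflect_line_axis1 reflect_line_axis2
  by (metis (no_types, lifting) image_eqI)

text \<open>Separation gives the bound on \<open>interior K\<close>; it extends to \<open>K\<close>,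
  which lies in the closure of its nonempty interior.\<close>

lemma convex_point_notin_interior_support:
  fixes K :: "'a::euclidean_space set"
  assumes "convex K" "interior K \<noteq> {}" "p \<notin> interior K"
  obtains a where "a \<noteq> 0" "\<And>x. x \<in> K \<Longrightarrow> a \<bullet> x \<le> a \<bullet> p"
proof -
  obtain a b where a: "a \<noteq> 0" "\<forall>x\<in>interior K. a \<bullet> x \<le> b" "b \<le> a \<bullet> p"
    using separating_hyperplane_sets[of "interior K" "{p}"] assms by (auto simp: convex_interior)
  have "closure (interior K) \<subseteq> {x. a \<bullet> x \<le> b}"
    using a by (intro closure_minimal closed_halfspace_le) auto
  then have "K \<subseteq> {x. a \<bullet> x \<le> b}"
    using convex_closure_interior[OF assms(1,2)] closure_subset by blast
  with a that show ?thesis by fastforce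
qed

text \<open>The weights are the absolute values of the coordinates of a normal \<open>a\<close>. A
  bound on \<open>a \<bullet> (x - z)\<close> over \<open>K\<close> becomes a rhombus bound when
  applied to suitable mirror images of \<open>x\<close>.\<close>

lemma lattice_free_unconditional_rhombus:
  fixes z :: "real^2"
  assumes K: "convex K" "lattice_free K"
    and s1: "\<And>x. x \<in> K \<Longrightarrow> vector [x $ 1, 2 * z $ 2 - x $ 2] \<in> K"
    and s2: "\<And>x. x \<in> K \<Longrightarrow> vector [2 * z $ 1 - x $ 1, x $ 2] \<in> K"
  obtains a1 a2 where "0 \<le> a1" "0 \<le> a2" "0 < a1 + a2"
    "\<And>x. x \<in> K \<Longrightarrow> a1 * \<bar>x $ 1 - z $ 1\<bar> + a2 * \<bar>x $ 2 - z $ 2\<bar> \<le> (a1 + a2) / 2"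
proof -
  \<comment> \<open>Rounding each coordinate gives a lattice point nearest to \<open>z\<close>; the
    offsets of at most \<open>1/2\<close> produce the right side of the rhombus bound.\<close>
  define p :: "real^2" where "p = (\<chi> i. of_int (round (z $ i)))"
  have p: "p \<notin> interior K" "\<bar>p $ i - z $ i\<bar> \<le> 1/2" for i
    using K of_int_round_abs_le[of "z $ i"]
    by (auto simp: lattice_free_def integer_lattice_def p_def)
  \<comment> \<open>Reflecting each coordinate if necessary makes both products in the inner product
    nonnegative.\<close>
  have flip: "\<exists>x'\<in>K. a \<bullet> (x' - z) = \<bar>a $ 1\<bar> * \<bar>x $ 1 - z $ 1\<bar> + \<bar>a $ 2\<bar> * \<bar>x $ 2 - z $ 2\<bar>"
    if "x \<in> K" for x a
  proof -
    define u where "u = (if 0 \<le> a $ 1 * (x $ 1 - z $ 1) then x $ 1 else 2 * z $ 1 - x $ 1)"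
    define v where "v = (if 0 \<le> a $ 2 * (x $ 2 - z $ 2) then x $ 2 else 2 * z $ 2 - x $ 2)"
    have "vector [x $ 1, x $ 2] = x" by (simp add: vec_eq_iff forall_2)
    then have "(vector [u, v] :: real^2) \<in> K"
      using that s1[OF that] s2[OF that] s1[OF s2[OF that]] by (auto simp: u_def v_def)
    moreover have "a $ 1 * (u - z $ 1) = \<bar>a $ 1\<bar> * \<bar>x $ 1 - z $ 1\<bar>"
      "a $ 2 * (v - z $ 2) = \<bar>a $ 2\<bar> * \<bar>x $ 2 - z $ 2\<bar>"
      by (auto simp: u_def v_def abs_mult[symmetric] algebra_simps)
    then have "a \<bullet> (vector [u, v] - z) = \<bar>a $ 1\<bar> * \<bar>x $ 1 - z $ 1\<bar> + \<bar>a $ 2\<bar> * \<bar>x $ 2 - z $ 2\<bar>"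
      by (simp add: inner_vec_def sum_2)
    ultimately show ?thesis by blast
  qed
  obtain a where a: "a \<noteq> 0" and le: "\<And>x. x \<in> K \<Longrightarrow> a \<bullet> (x - z) \<le> (\<bar>a $ 1\<bar> + \<bar>a $ 2\<bar>) / 2"
  proof (cases "interior K = {}")
    case True
    then obtain a b where a: "a \<noteq> 0" "K \<subseteq> {x. a \<bullet> x = b}"
      using empty_interior_subset_hyperplane K by metis
    have "a \<bullet> (x - z) \<le> (\<bar>a $ 1\<bar> + \<bar>a $ 2\<bar>) / 2" if "x \<in> K" for x
    proof -
      \<comment> \<open>A flat \<open>K\<close> lies on a line, which contains both \<open>x\<close>
        and its point reflection in \<open>z\<close>, and therefore also \<open>z\<close>.\<close>
      have "a \<bullet> x = b" "a \<bullet> vector [2 * z $ 1 - x $ 1, 2 * z $ 2 - x $ 2] = b"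
        using a that s1[OF s2[OF that]] by auto
      then have "a \<bullet> (x - z) = 0"
        by (simp add: inner_vec_def sum_2 algebra_simps)
      then show ?thesis by simp
    qed
    with a(1) show ?thesis by (rule that)
  next
    case False
    then obtain a where a: "a \<noteq> 0" "\<And>x. x \<in> K \<Longrightarrow> a \<bullet> x \<le> a \<bullet> p"
      using convex_point_notin_interior_support K p by metis
    have "a $ i * (p $ i - z $ i) \<le> \<bar>a $ i\<bar> * (1/2)" for i
    proof -
      have "a $ i * (p $ i - z $ i) \<le> \<bar>a $ i\<bar> * \<bar>p $ i - z $ i\<bar>"
        by (simp flip: abs_mult)
      also have "\<dots> \<le> \<bar>a $ i\<bar> * (1/2)"
        using p(2)[of i] by (rule mult_left_mono) simp
      finally show ?thesis .
    qed
    from add_mono[OF this[of 1] this[of 2]]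
    have "a \<bullet> (p - z) \<le> (\<bar>a $ 1\<bar> + \<bar>a $ 2\<bar>) / 2"
      by (simp add: inner_vec_def sum_2)
    then have "a \<bullet> (x - z) \<le> (\<bar>a $ 1\<bar> + \<bar>a $ 2\<bar>) / 2" if "x \<in> K" for x
      using a(2)[OF that] by (simp add: inner_diff_right)
    with a(1) show ?thesis by (rule that)
  qed
  show ?thesis
  proof (rule that)
    show "0 < \<bar>a $ 1\<bar> + \<bar>a $ 2\<bar>"
      using a by (auto simp: vec_eq_iff forall_2)
    show "\<bar>a $ 1\<bar> * \<bar>x $ 1 - z $ 1\<bar> + \<bar>a $ 2\<bar> * \<bar>x $ 2 - z $ 2\<bar> \<le> (\<bar>a $ 1\<bar> + \<bar>a $ 2\<bar>) / 2"
      if "x \<in> K" for x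
      using flip[OF that, of a] le by metis
  qed auto
qed

section \<open>Circumradius and perimeter of unconditional bodies\<close>

text \<open>By the triangle inequality no disk containing \<open>K\<close> has radius below half the
  diameter; \<open>ball\<close> says that this radius is attained.\<close>

lemma circumradius_eq_half_diameter:
  assumes K: "K \<noteq> {}" "bounded K" and ball: "K \<subseteq> cball z (diameter K / 2)"
  shows "circumradius K = diameter K / 2"
  unfolding circumradius_def
proof (rule cInf_eq_minimum)
  show "diameter K / 2 \<in> {r. 0 \<le> r \<and> (\<exists>c. K \<subseteq> cball c r)}"
    using ball diameter_ge_0[OF K(2)] by auto
  fix r assume "r \<in> {r. 0 \<le> r \<and> (\<exists>c. K \<subseteq> cball c r)}"
  then obtain c where c: "K \<subseteq> cball c r" by blast
  have "dist x y \<le> 2 * r" if "x \<in> K" "y \<in> K" for x y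
    using dist_triangle3[of x y c] c that by (auto simp: subset_eq mem_cball) (smt (verit))
  then have "diameter K \<le> 2 * r"
    unfolding diameter_def using K(1) by (auto intro!: cSUP_least)
  then show "diameter K / 2 \<le> r" by simp
qed

text \<open>A closed set contains its frontier, so polygons in \<open>K\<close> may be considered
  instead. The empty polygon, of length \<open>0\<close>, accounts for
  \<open>0 \<le> B\<close>.\<close>

lemma perimeter_le:
  assumes "closed K" "0 \<le> B"
    and "\<And>xs. ccw_polygon xs \<Longrightarrow> xs \<noteq> [] \<Longrightarrow> set xs \<subseteq> K \<Longrightarrow> closed_polygon_length xs \<le> B"
  shows "perimeter K \<le> B"
  unfolding perimeter_def
proof (rule cSup_least)
  show "{closed_polygon_length xs | xs. set xs \<subseteq> frontier K \<and> ccw_polygon xs} \<noteq> {}"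
    by (auto intro!: exI[of _ "[]"] simp: ccw_polygon_def)
  fix y assume "y \<in> {closed_polygon_length xs | xs. set xs \<subseteq> frontier K \<and> ccw_polygon xs}"
  then obtain xs where xs: "y = closed_polygon_length xs" "set xs \<subseteq> K" "ccw_polygon xs"
    using frontier_subset_closed[OF assms(1)] by blast
  then show "y \<le> B"
    using assms(2,3) by (cases "xs = []") (auto simp: closed_polygon_length_def)
qed

lemma closed_polygon_length_le_perimeter:
  assumes "compact K" "set xs \<subseteq> frontier K" "ccw_polygon xs"
  shows "closed_polygon_length xs \<le> perimeter K"
  unfolding perimeter_def
proof (rule cSup_upper)
  show "closed_polygon_length xs \<in> {closed_polygon_length xs | xs. set xs \<subseteq> frontier K \<and> ccw_polygon xs}"
    using assms by blast
  obtain R where R: "0 < R" "\<And>x. x \<in> K \<Longrightarrow> norm x \<le> R"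
    using compact_imp_bounded[OF assms(1)] by (auto simp: bounded_pos)
  \<comment> \<open>An upper bound for the real supremum comes from the disk estimate around the
    origin.\<close>
  show "bdd_above {closed_polygon_length xs | xs. set xs \<subseteq> frontier K \<and> ccw_polygon xs}"
  proof (rule bdd_aboveI)
    fix y assume "y \<in> {closed_polygon_length xs | xs. set xs \<subseteq> frontier K \<and> ccw_polygon xs}"
    then obtain ys where ys: "y = closed_polygon_length ys" "set ys \<subseteq> K" "ccw_polygon ys"
      using frontier_subset_closed[OF compact_imp_closed[OF assms(1)]] by blast
    show "y \<le> 2 * pi * R"
    proof (cases "ys = []")
      case True
      then show ?thesis using ys R(1) by (simp add: closed_polygon_length_def)
    next
      case False
      show ?thesis
        unfolding ys(1)
        by (rule closed_polygon_length_le_circle[OF ys(3) False, where z = 0]) (use ys R in auto)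
    qed
  qed
qed

lemma unconditional_circumradius_perimeter:
  assumes K: "K \<noteq> {}" "compact K" "convex K" "lattice_free K" "unconditional K"
  shows "2 * circumradius K = diameter K" "perimeter K \<le> 2 * diameter K + 2"
proof -
  obtain z :: "real^2" where s1: "\<And>x. x \<in> K \<Longrightarrow> vector [x $ 1, 2 * z $ 2 - x $ 2] \<in> K"
    and s2: "\<And>x. x \<in> K \<Longrightarrow> vector [2 * z $ 1 - x $ 1, x $ 2] \<in> K"
    using unconditional_centre[OF K(5)] by metis
  note bounded = compact_imp_bounded[OF K(2)]
  have ball: "norm (x - z) \<le> diameter K / 2" if "x \<in> K" for x
  proof -
    \<comment> \<open>The two reflections compose to the point reflection in \<open>z\<close>, so
      \<open>x\<close> and its image are at distance \<open>2 * norm (x - z)\<close>.\<close>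
    have "vector [2 * z $ 1 - x $ 1, 2 * z $ 2 - x $ 2] = 2 *\<^sub>R z - x"
      by (simp add: vec_eq_iff forall_2)
    then have "2 *\<^sub>R z - x \<in> K" using s1[OF s2[OF that]] by simp
    then have "dist x (2 *\<^sub>R z - x) \<le> diameter K"
      using diameter_bounded_bound[OF bounded that] by simp
    moreover have "x - (2 *\<^sub>R z - x) = 2 *\<^sub>R (x - z)"
      by (simp add: algebra_simps scaleR_2)
    ultimately show ?thesis by (simp add: dist_norm)
  qed
  then have "K \<subseteq> cball z (diameter K / 2)"
    by (auto simp: dist_norm norm_minus_commute)
  from circumradius_eq_half_diameter[OF K(1) bounded this]
  show "2 * circumradius K = diameter K" by simp
  obtain a1 a2 where a: "0 \<le> a1" "0 \<le> a2" "0 < a1 + a2"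
    and rhombus: "\<And>x. x \<in> K \<Longrightarrow> a1 * \<bar>x $ 1 - z $ 1\<bar> + a2 * \<bar>x $ 2 - z $ 2\<bar> \<le> (a1 + a2) / 2"
    using lattice_free_unconditional_rhombus[OF K(3,4) s1 s2] by metis
  show "perimeter K \<le> 2 * diameter K + 2"
  proof (rule perimeter_le)
    show "closed K" by (rule compact_imp_closed[OF K(2)])
    show "0 \<le> 2 * diameter K + 2" using diameter_ge_0[OF bounded] by simp
    fix xs assume xs: "ccw_polygon xs" "xs \<noteq> []" "set xs \<subseteq> K"
    have "closed_polygon_length xs \<le> 4 * (diameter K / 2) + 2"
      by (rule closed_polygon_length_le_rhombus[OF xs(1,2) _ a]) (use xs ball rhombus in auto)
    then show "closed_polygon_length xs \<le> 2 * diameter K + 2" by simp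
  qed
qed

section \<open>Long boxes\<close>

text \<open>The box fits between two consecutive horizontal lattice lines. Its corners give
  perimeter at least \<open>4 * a + 2\<close>, while its diameter exceeds \<open>2 * a\<close> by at
  most \<open>1 / (4 * a)\<close>.\<close>

lemma long_box_perimeter_diameter:
  fixes a :: real
  assumes a: "0 < a"
  defines "K \<equiv> cbox (vector [-a, 0]) (vector [a, 1]) :: (real^2) set"
  shows "K \<noteq> {}" "compact K" "convex K" "lattice_free K" "unconditional K"
    "2 - 1 / (2 * a) \<le> perimeter K - 2 * diameter K"
proof -
  have mem: "x \<in> K \<longleftrightarrow> -a \<le> x $ 1 \<and> x $ 1 \<le> a \<and> 0 \<le> x $ 2 \<and> x $ 2 \<le> 1" for x
    by (auto simp: K_def mem_box_cart forall_2)
  have int: "x \<in> interior K \<longleftrightarrow> -a < x $ 1 \<and> x $ 1 < a \<and> 0 < x $ 2 \<and> x $ 2 < 1" for x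
    by (auto simp: K_def interior_cbox mem_box_cart forall_2)
  have "(vector [0, 0] :: real^2) \<in> K" using a by (simp add: mem)
  then show ne: "K \<noteq> {}" by blast
  show comp: "compact K" and "convex K" by (auto simp: K_def)
  show "lattice_free K"
    unfolding lattice_free_def
  proof (intro equals0I)
    fix x assume "x \<in> interior K \<inter> integer_lattice"
    then have "0 < x $ 2" "x $ 2 < 1" "x $ 2 \<in> \<int>"
      by (auto simp: int integer_lattice_def)
    then show False by (auto elim!: Ints_cases)
  qed
  define z :: "real^2" where "z = vector [0, 1/2]"
  have "reflect_line z (axis 1 1) ` K = K"
  proof
    show "K \<subseteq> reflect_line z (axis 1 1) ` K"
    proof
      fix x assume "x \<in> K"
      then show "x \<in> reflect_line z (axis 1 1) ` K"
        by (intro image_eqI[of _ _ "vector [x $ 1, 1 - x $ 2]"])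
           (auto simp: reflect_line_axis1 mem z_def vec_eq_iff forall_2)
    qed
  qed (auto simp: reflect_line_axis1 mem z_def)
  moreover have "reflect_line z (axis 2 1) ` K = K"
  proof
    show "K \<subseteq> reflect_line z (axis 2 1) ` K"
    proof
      fix x assume "x \<in> K"
      then show "x \<in> reflect_line z (axis 2 1) ` K"
        by (intro image_eqI[of _ _ "vector [- x $ 1, x $ 2]"])
           (auto simp: reflect_line_axis2 mem z_def vec_eq_iff forall_2)
    qed
  qed (auto simp: reflect_line_axis2 mem z_def)
  ultimately show "unconditional K" unfolding unconditional_def by blast
  define xs :: "(real^2) list" where
    "xs = [vector [-a, 0], vector [a, 0], vector [a, 1], vector [-a, 1]]"
  have "closed K" using comp by (rule compact_imp_closed)
  then have "set xs \<subseteq> frontier K"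
    using a by (auto simp: xs_def frontier_def closure_closed mem int)
  moreover have "ccw_polygon xs"
    unfolding ccw_polygon_def
  proof (intro allI impI)
    fix i j k assume ijk: "i < j" "j < k" "k < length xs"
    then have "(i, j, k) \<in> {(0, 1, 2), (0, 1, 3), (0, 2, 3), (1, 2, 3)}"
      by (auto simp: xs_def)
    then show "0 < orient (xs ! i) (xs ! j) (xs ! k)"
      using a by (auto simp: xs_def orient_def)
  qed
  moreover have "closed_polygon_length xs = 4 * a + 2"
    using a by (simp add: closed_polygon_length_def xs_def dist_real2 lessThan_nat_numeral lessThan_Suc real_sqrt_mult)
  ultimately have per: "4 * a + 2 \<le> perimeter K"
    using closed_polygon_length_le_perimeter[OF comp, of xs] by simp
  \<comment> \<open>The first-order upper bound for \<open>sqrt ((2 * a)\<^sup>2 + 1)\<close>: its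
    square has the cross term \<open>1\<close>.\<close>
  have "diameter K \<le> 2 * a + 1 / (4 * a)"
  proof (rule diameter_le)
    fix x y assume xy: "x \<in> K" "y \<in> K"
    show "norm (x - y) \<le> 2 * a + 1 / (4 * a)"
    proof (rule power2_le_imp_le)
      have "\<bar>(x - y) $ 1\<bar> \<le> 2 * a" "\<bar>(x - y) $ 2\<bar> \<le> 1"
        using xy by (auto simp: mem abs_le_iff)
      then have "((x - y) $ 1)\<^sup>2 \<le> (2 * a)\<^sup>2" "((x - y) $ 2)\<^sup>2 \<le> 1\<^sup>2"
        using a by (auto simp only: abs_le_square_iff[symmetric] abs_of_pos abs_one)
      then have "(norm (x - y))\<^sup>2 \<le> (2 * a)\<^sup>2 + 1"
        unfolding norm_real2_eq by simp
      also have "\<dots> \<le> (2 * a + 1 / (4 * a))\<^sup>2"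
        using a by (simp add: power2_sum)
      finally show "(norm (x - y))\<^sup>2 \<le> (2 * a + 1 / (4 * a))\<^sup>2" .
    qed (use a in simp)
  qed (use ne in simp)
  with per show "2 - 1 / (2 * a) \<le> perimeter K - 2 * diameter K" by simp
qed

theorem theorem1p1:
  "(\<forall>K :: (real^2) set.
      K \<noteq> {} \<longrightarrow> compact K \<longrightarrow> convex K \<longrightarrow> lattice_free K \<longrightarrow> unconditional K \<longrightarrow>
        perimeter K - 2 * diameter K = perimeter K - 4 * circumradius K \<and>
        perimeter K - 4 * circumradius K \<le> 2) \<and>
   \<not> (\<exists>c<2. \<forall>K :: (real^2) set.
      K \<noteq> {} \<longrightarrow> compact K \<longrightarrow> convex K \<longrightarrow> lattice_free K \<longrightarrow> unconditional K \<longrightarrow>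
        perimeter K - 2 * diameter K \<le> c)"
proof (intro conjI notI)
  show "\<forall>K :: (real^2) set.
      K \<noteq> {} \<longrightarrow> compact K \<longrightarrow> convex K \<longrightarrow> lattice_free K \<longrightarrow> unconditional K \<longrightarrow>
        perimeter K - 2 * diameter K = perimeter K - 4 * circumradius K \<and>
        perimeter K - 4 * circumradius K \<le> 2"
  proof (intro allI impI)
    fix K :: "(real^2) set"
    assume "K \<noteq> {}" "compact K" "convex K" "lattice_free K" "unconditional K"
    note unconditional_circumradius_perimeter[OF this]
    then show "perimeter K - 2 * diameter K = perimeter K - 4 * circumradius K \<and>
        perimeter K - 4 * circumradius K \<le> 2" by simp
  qed
  assume "\<exists>c<2. \<forall>K :: (real^2) set.
      K \<noteq> {} \<longrightarrow> compact K \<longrightarrow> convex K \<longrightarrow> lattice_free K \<longrightarrow> unconditional K \<longrightarrow>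
        perimeter K - 2 * diameter K \<le> c"
  then obtain c where c: "c < 2" and le: "\<And>K :: (real^2) set.
      K \<noteq> {} \<Longrightarrow> compact K \<Longrightarrow> convex K \<Longrightarrow> lattice_free K \<Longrightarrow> unconditional K \<Longrightarrow>
        perimeter K - 2 * diameter K \<le> c" by blast
  \<comment> \<open>With this width \<open>2 - 1 / (2 * a)\<close> equals \<open>1 + c / 2\<close>,
    the midpoint of \<open>c\<close> and \<open>2\<close>, which exceeds \<open>c\<close>.\<close>
  define a where "a = 1 / (2 - c)"
  have a: "0 < a" using c by (simp add: a_def)
  have "2 - 1 / (2 * a) \<le> c"
    using long_box_perimeter_diameter(6)[OF a] le[OF long_box_perimeter_diameter(1-5)[OF a]]
    by (rule order_trans)
  then show False using c by (simp add: a_def field_simps)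
qed

end
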